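(* Let $F\in\mathbb{R}^{M\times N}$, $\mathbf{y}\in\mathbb{R}^M$, and let $R\in\mathbb{R}^{K\times N}$ satisfy $\ker(F)\cap\ker(R)=\{\mathbf{0}_N\}$. Let $r,\tilde r\in\mathbb{R}\setminus\{0\}$, $\beta,\tilde\beta>0$, $\vartheta_1,\dots,\vartheta_K>0$, $\tilde\vartheta>0$, $\eta=r\beta-\tfrac32$, $\tilde\eta=\tilde r\tilde\beta-\tfrac{M+2}{2}$. Assume that either ($r<0$ and $\eta<-\tfrac32$) or ($r>0$ and $\eta>0$), and that either ($\tilde r<0$ and $\tilde\eta<-\tfrac{M+2}{2}$) or ($\tilde r>0$ and $\tilde\eta>0$). Let $\mathcal{G}$ be the objective function and $\{(\mathbf{x}^{(k)},\boldsymbol{\theta}^{(k)},\nu^{(k)})\}$ the sequence of iterates of the generalized IAS algorithm, both defined in the context, started from an arbitrary $\mathbf{x}^{(0)}\in\mathbb{R}^N$. Then $\{(\mathbf{x}^{(k)},\boldsymbol{\theta}^{(k)},\nu^{(k)})\}$ is bounded, and any limit point of $\{(\mathbf{x}^{(k)},\boldsymbol{\theta}^{(k)},\nu^{(k)})\}$ is a stationary point of $\mathcal{G}$.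
   Context: $D_{\boldsymbol{\theta}}=\operatorname{diag}(\theta_1,\dots,\theta_K)$. The objective $\mathcal{G}:\mathbb{R}^N\times\mathbb{R}^K\times\mathbb{R}\to\mathbb{R}\cup\{+\infty\}$ is $$\mathcal{G}(\mathbf{x},\boldsymbol{\theta},\nu)=\frac{1}{2\nu}\|F\mathbf{x}-\mathbf{y}\|_2^2+\frac12\|D_{\boldsymbol{\theta}}^{-1/2}R\mathbf{x}\|_2^2+\left(\frac{\nu}{\tilde\vartheta}\right)^{\tilde r}+\sum_{i=1}^K\left(\frac{\theta_i}{\vartheta_i}\right)^r-\tilde\eta\log\nu-\eta\sum_{i=1}^K\log\theta_i$$ if $\nu>0$ and all $\theta_i>0$, and $\mathcal{G}=+\infty$ otherwise. The generalized IAS algorithm is exact block-coordinate minimization: given $\mathbf{x}^{(0)}\in\mathbb{R}^N$, for $k=0,1,2,\dots$, $\boldsymbol{\theta}^{(k+1)}$ is the unique minimizer over $\boldsymbol{\theta}$ of $\mathcal{G}(\mathbf{x}^{(k)},\boldsymbol{\theta},\nu)$ (it does not depend on $\nu>0$); $\nu^{(k+1)}$ is the unique minimizer over $\nu$ of $\mathcal{G}(\mathbf{x}^{(k)},\boldsymbol{\theta}^{(k+1)},\nu)$; and $\mathbf{x}^{(k+1)}$ is the unique minimizer over $\mathbf{x}$ of $\mathcal{G}(\mathbf{x},\boldsymbol{\theta}^{(k+1)},\nu^{(k+1)})$. The sequence of iterates is indexed by $k\ge1$; no stopping criterion is applied. A point $\mathbf{z}$ is a stationary point of an extended real-valued function $\mathcal{F}$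 if $\mathbf{0}\in\partial\mathcal{F}(\mathbf{z})$, where $\partial\mathcal{F}$ is the limiting (Mordukhovich) subdifferential; at points where $\mathcal{F}$ is continuously differentiable (for $\mathcal{G}$: all points with $\nu>0$ and all $\theta_i>0$), $\partial\mathcal{F}(\mathbf{z})=\{\nabla\mathcal{F}(\mathbf{z})\}$. Points where $\mathcal{G}=+\infty$ are not stationary. *)

theory Defs
  imports "HOL-Analysis.Analysis"
begin

definition diag_matrix :: "real ^ 'k \<Rightarrow> real ^ 'k ^ 'k" where
  "diag_matrix d = (\<chi> i j. if i = j then d $ i else 0)"

text \<open>The objective. The matrix \<open>diag_matrix (\<chi> i. \<theta> $ i powr (-1/2))\<close> is
  \<open>D\<close> to the power \<open>-1/2\<close>, where \<open>D = diag_matrix \<theta>\<close>.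
  The arguments \<open>r\<close>, \<open>vt\<close>, \<open>\<eta>\<close> are the exponent, the scales and the log-coefficient for \<open>\<theta>\<close>;
  \<open>rn\<close>, \<open>vn\<close>, \<open>en\<close> are their counterparts (written with a tilde on paper) for \<open>\<nu>\<close>.\<close>

definition ias_objective ::
  "real ^ 'n ^ 'm \<Rightarrow> real ^ 'm \<Rightarrow> real ^ 'n ^ 'k \<Rightarrow> real \<Rightarrow> real ^ 'k \<Rightarrow> real \<Rightarrow>
   real \<Rightarrow> real \<Rightarrow> real \<Rightarrow> real ^ 'n \<Rightarrow> real ^ 'k \<Rightarrow> real \<Rightarrow> ereal" where
  "ias_objective F y R r vt \<eta> rn vn en x \<theta> \<nu> =
     (if \<nu> > 0 \<and> (\<forall>i. \<theta> $ i > 0) then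
        ereal (1 / (2 * \<nu>) * (norm (F *v x - y))\<^sup>2
             + 1 / 2 * (norm (diag_matrix (\<chi> i. \<theta> $ i powr (-1/2)) *v (R *v x)))\<^sup>2
             + (\<nu> / vn) powr rn
             + (\<Sum>i\<in>UNIV. (\<theta> $ i / vt $ i) powr r)
             - en * ln \<nu>
             - \<eta> * (\<Sum>i\<in>UNIV. ln (\<theta> $ i)))
      else \<infinity>)"

text \<open>Exact block-coordinate minimization of a function of three blocks. The minimizer over
  \<open>\<theta>\<close> is required to be the same one for every \<open>\<nu> > 0\<close>.\<close>

definition theta_update ::
  "('a \<Rightarrow> 'b \<Rightarrow> real \<Rightarrow> ereal) \<Rightarrow> 'a \<Rightarrow> 'b" where
  "theta_update G x = (THE \<theta>. \<forall>\<nu>>0. is_arg_min (\<lambda>\<theta>'. G x \<theta>' \<nu>) (\<lambda>_. True) \<theta>)"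

definition nu_update ::
  "('a \<Rightarrow> 'b \<Rightarrow> real \<Rightarrow> ereal) \<Rightarrow> 'a \<Rightarrow> 'b \<Rightarrow> real" where
  "nu_update G x \<theta> = (THE \<nu>. is_arg_min (\<lambda>\<nu>'. G x \<theta> \<nu>') (\<lambda>_. True) \<nu>)"

definition x_update ::
  "('a \<Rightarrow> 'b \<Rightarrow> real \<Rightarrow> ereal) \<Rightarrow> 'b \<Rightarrow> real \<Rightarrow> 'a" where
  "x_update G \<theta> \<nu> = (THE x. is_arg_min (\<lambda>x'. G x' \<theta> \<nu>) (\<lambda>_. True) x)"

definition ias_step ::
  "('a \<Rightarrow> 'b \<Rightarrow> real \<Rightarrow> ereal) \<Rightarrow> 'a \<Rightarrow> 'a \<times> 'b \<times> real" where
  "ias_step G x =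
     (let \<theta> = theta_update G x; \<nu> = nu_update G x \<theta> in (x_update G \<theta> \<nu>, \<theta>, \<nu>))"

text \<open>Only \<open>x\<close> has a zeroth iterate, so the sequence of triples starts with the first iterate:
  \<open>ias_iterate G x0 k\<close> is the triple of iterates with index \<open>k + 1\<close>.\<close>

primrec ias_iterate ::
  "('a \<Rightarrow> 'b \<Rightarrow> real \<Rightarrow> ereal) \<Rightarrow> 'a \<Rightarrow> nat \<Rightarrow> 'a \<times> 'b \<times> real" where
  "ias_iterate G x0 0 = ias_step G x0"
| "ias_iterate G x0 (Suc k) = ias_step G (fst (ias_iterate G x0 k))"

definition sequence_limit_point :: "(nat \<Rightarrow> 'a::topological_space) \<Rightarrow> 'a \<Rightarrow> bool" where
  "sequence_limit_point X z \<longleftrightarrow> (\<exists>s. strict_mono s \<and> (X \<circ> s) \<longlonglongrightarrow> z)"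

text \<open>The regular (Frechet) subdifferential, and the limiting (Mordukhovich) subdifferential
  built from it. Both are empty at points where the function is not finite.\<close>

definition regular_subdifferential :: "('a::euclidean_space \<Rightarrow> ereal) \<Rightarrow> 'a \<Rightarrow> 'a set" where
  "regular_subdifferential f z =
     {v. \<bar>f z\<bar> \<noteq> \<infinity> \<and>
         0 \<le> Liminf (at z) (\<lambda>w. (f w - f z - ereal (v \<bullet> (w - z))) / ereal (norm (w - z)))}"

definition limiting_subdifferential :: "('a::euclidean_space \<Rightarrow> ereal) \<Rightarrow> 'a \<Rightarrow> 'a set" where
  "limiting_subdifferential f z =
     {v. \<bar>f z\<bar> \<noteq> \<infinity> \<and>
         (\<exists>Z V. Z \<longlonglongrightarrow> z \<and> (\<lambda>j. f (Z j)) \<longlonglongrightarrow> f z \<and>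
                (\<forall>j. V j \<in> regular_subdifferential f (Z j)) \<and> V \<longlonglongrightarrow> v)}"

definition stationary_point :: "('a::euclidean_space \<Rightarrow> ereal) \<Rightarrow> 'a \<Rightarrow> bool" where
  "stationary_point f z \<longleftrightarrow> 0 \<in> limiting_subdifferential f z"

end

theory Submission
  imports Defs
begin

text \<open>
  The objective is a sum of one-dimensional costs \<open>a / t + (t / v) powr p - c * ln t\<close>, one for
  each scale \<open>t = \<theta> $ i\<close> and one for \<open>t = \<nu>\<close>, where only the residual \<open>a\<close> depends on \<open>x\<close>. The
  sign assumptions of the theorem make \<open>p\<close> and \<open>c\<close> have the same sign, and this one condition
  serves twice. In the variable \<open>ln t\<close> the cost is strictly convex, and it grows at
  least like \<open>\<bar>c\<bar> * \<bar>ln t\<bar>\<close>, uniformly in \<open>a\<close> (\<open>scale_cost_coercive\<close>). Hence the scale updates are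
  well defined (\<open>scale_cost_unique_min\<close>), and on a sublevel set of the objective the scales stay
  in a compact subset of the open half-line (\<open>sublevel_set_in_compact\<close>). There the residuals
  \<open>F *v x - y\<close> and \<open>R *v x\<close> are bounded too, and so is \<open>x\<close>, because \<open>F\<close> and \<open>R\<close> have no common
  kernel. The \<open>x\<close> update is a least-squares problem with an injective linear map. As the
  objective never increases along the iteration, the iterates are bounded and their limit points
  have positive scales.

  Minimizing over \<open>\<theta>\<close> and then over \<open>\<nu>\<close> minimizes over the pair, because the minimizing
  \<open>\<theta>\<close> is the same for every \<open>\<nu>\<close>. So the algorithm alternates between two blocks, \<open>x\<close> and
  \<open>w = (\<theta>, \<nu>)\<close>, of the objective \<open>f (x, w)\<close>. Let \<open>L\<close> be the objective value at the limit \<open>(x, w)\<close> of a subsequence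
  \<open>(X (s j), W (s j))\<close>. By monotonicity \<open>L\<close> is below all values along the iteration, so the
  iterate that follows \<open>X (s j)\<close> gives \<open>L \<le> f (X (s j), w')\<close> for every \<open>w'\<close>; in the limit \<open>w\<close>
  minimizes \<open>f (x, _)\<close>. Minimality of \<open>x\<close> in \<open>f (_, w)\<close> passes to the limit directly
  (\<open>alternating_minimization_limit\<close>). Finally, the objective is differentiable near the limit
  point, so minimality in each block makes its derivative vanish, and a zero derivative is a zero
  Frechet subgradient.
\<close>

section \<open>The one-dimensional subproblem\<close>

text \<open>The part of the objective that depends on one scale \<open>t\<close>; \<open>a\<close> is half the squared residual
  attached to that scale.\<close>

definition scale_cost :: "real \<Rightarrow> real \<Rightarrow> real \<Rightarrow> real \<Rightarrow> real \<Rightarrow> real" where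
  "scale_cost a v p c t = a / t + (t / v) powr p - c * ln t"

lemma scale_cost_exp:
  assumes "v > 0"
  shows "scale_cost a v p c (exp u) = a * exp (- u) + exp (p * (u - ln v)) - c * u"
  using assms by (simp add: scale_cost_def powr_def ln_div exp_minus divide_simps)

text \<open>With \<open>s = p * (ln t - ln v)\<close> and \<open>k = c / p > 0\<close> the cost is \<open>a / t + exp s - k * s\<close> up to a
  constant, and \<open>exp s\<close> beats \<open>2 * k * s\<close> at \<open>+\<infinity>\<close> while \<open>- k * s\<close> alone grows at \<open>-\<infinity>\<close>. The
  constant \<open>C\<close> is the same for all \<open>a\<close>, and the term \<open>a / t\<close> is kept, because the bounds must hold
  for all iterates at once and must also control the residual \<open>a\<close>.\<close>

lemma scale_cost_coercive:
  assumes "p * c > 0" "v > 0"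
  shows "\<exists>C. \<forall>a. \<forall>t>0. a / t + \<bar>c\<bar> * \<bar>ln t\<bar> - C \<le> scale_cost a v p c t"
proof -
  define k where "k = c / p"
  have p: "p \<noteq> 0" using assms by auto
  have k: "k > 0" using assms p by (auto simp: k_def zero_less_divide_iff zero_less_mult_iff)
  have c: "c = k * p" using p by (simp add: k_def)
  have "a / t + \<bar>c\<bar> * \<bar>ln t\<bar> - (2 * k * \<bar>1 - ln (2 * k)\<bar> + 2 * \<bar>c\<bar> * \<bar>ln v\<bar>)
      \<le> scale_cost a v p c t" if t: "t > 0" for a t
  proof -
    define s where "s = p * (ln t - ln v)"
    \<comment> \<open>The tangent line of \<open>exp\<close> with slope \<open>2 * k\<close>; it touches at \<open>ln (2 * k)\<close>.\<close>
    have "exp (s - ln (2 * k)) \<ge> 1 + (s - ln (2 * k))" by (rule exp_ge_add_one_self)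
    then have "exp s / (2 * k) \<ge> 1 + (s - ln (2 * k))" using k by (simp add: exp_diff)
    then have tangent: "exp s \<ge> 2 * k * (1 + (s - ln (2 * k)))"
      using k by (simp add: field_simps)
    have "exp s - k * s \<ge> k * \<bar>s\<bar> - 2 * k * \<bar>1 - ln (2 * k)\<bar>"
    proof (cases "s \<ge> 0")
      case True
      have "2 * k * (1 - ln (2 * k)) \<ge> - (2 * k * \<bar>1 - ln (2 * k)\<bar>)"
        using k mult_left_mono[of "- \<bar>1 - ln (2 * k)\<bar>" "1 - ln (2 * k)" "2 * k"] by simp
      then show ?thesis using tangent True by (simp add: algebra_simps)
    next
      case False
      have "0 \<le> 2 * k * \<bar>1 - ln (2 * k)\<bar>" using k by simp
      moreover have "k * \<bar>s\<bar> = - (k * s)" using False by simp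
      ultimately show ?thesis using exp_ge_zero[of s] by linarith
    qed
    moreover have "k * \<bar>s\<bar> = \<bar>c\<bar> * \<bar>ln t - ln v\<bar>"
      using k by (simp add: c s_def abs_mult)
    moreover have "\<bar>c\<bar> * \<bar>ln t - ln v\<bar> \<ge> \<bar>c\<bar> * (\<bar>ln t\<bar> - \<bar>ln v\<bar>)"
      by (intro mult_left_mono) auto
    moreover have "- (c * ln v) \<ge> - (\<bar>c\<bar> * \<bar>ln v\<bar>)"
      using abs_ge_self[of "c * ln v"] by (simp add: abs_mult)
    moreover have "scale_cost a v p c t = a / t + exp s - k * s - c * ln v"
      using t assms by (simp add: scale_cost_def powr_def ln_div s_def c algebra_simps)
    ultimately show ?thesis by (simp add: algebra_simps)
  qed
  then show ?thesis by blast
qed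

text \<open>In the variable \<open>u = ln t\<close> the cost is a continuous coercive function, so it attains its
  minimum, and \<open>exp (p * (u - ln v))\<close> makes it strictly convex since \<open>p \<noteq> 0\<close>: the midpoint of two
  different minimizers would be strictly better.\<close>

lemma scale_cost_unique_min:
  assumes pc: "p * c > 0" and v: "v > 0" and a: "a \<ge> 0"
  shows "\<exists>m>0. \<forall>t>0. t \<noteq> m \<longrightarrow> scale_cost a v p c m < scale_cost a v p c t"
proof -
  define f where "f u = scale_cost a v p c (exp u)" for u
  have f: "f u = a * exp (- u) + exp (p * (u - ln v)) - c * u" for u
    unfolding f_def by (rule scale_cost_exp[OF v])
  have c: "\<bar>c\<bar> > 0" and p: "p \<noteq> 0" using pc by auto
  obtain C where "\<And>t. t > 0 \<Longrightarrow> a / t + \<bar>c\<bar> * \<bar>ln t\<bar> - C \<le> scale_cost a v p c t"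
    using scale_cost_coercive[OF pc v] by blast
  then have "a / exp u + \<bar>c\<bar> * \<bar>u\<bar> - C \<le> f u" for u
    unfolding f_def by (metis exp_gt_zero ln_exp)
  moreover have "a / exp u \<ge> 0" for u using a by simp
  ultimately have C: "\<bar>c\<bar> * \<bar>u\<bar> - C \<le> f u" for u
    by (smt (verit))
  \<comment> \<open>Outside \<open>{-B..B}\<close> the coercive lower bound exceeds \<open>f 0\<close>.\<close>
  define B where "B = (f 0 + C) / \<bar>c\<bar>"
  have "B \<ge> 0" using C[of 0] c by (simp add: B_def)
  moreover have "continuous_on {-B..B} f"
    unfolding f by (intro continuous_intros)
  ultimately obtain m where m: "m \<in> {-B..B}" "\<And>u. u \<in> {-B..B} \<Longrightarrow> f m \<le> f u"
    using continuous_attains_inf[of "{-B..B}" f] by auto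
  have min: "f m \<le> f u" for u
  proof (cases "\<bar>u\<bar> \<le> B")
    case True
    then show ?thesis by (intro m(2)) (simp add: abs_le_iff minus_le_iff)
  next
    case False
    then have "\<bar>c\<bar> * \<bar>u\<bar> > f 0 + C"
      using c by (simp add: B_def field_simps)
    then show ?thesis using C[of u] m(2)[of 0] \<open>B \<ge> 0\<close> by auto
  qed
  have square: "exp x + exp y - 2 * exp ((x + y) / 2) = (exp (x / 2) - exp (y / 2))\<^sup>2" for x y :: real
    by (simp add: power2_diff exp_double[symmetric] exp_add[symmetric] add_divide_distrib)
  have mid: "exp ((x + y) / 2) \<le> (exp x + exp y) / 2" for x y :: real
  proof -
    have "0 \<le> exp x + exp y - 2 * exp ((x + y) / 2)" unfolding square by simp
    then show ?thesis by simp
  qed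
  have strict: "exp ((x + y) / 2) < (exp x + exp y) / 2" if "x \<noteq> y" for x y :: real
  proof -
    have "0 < exp x + exp y - 2 * exp ((x + y) / 2)" unfolding square using that by simp
    then show ?thesis by simp
  qed
  have "f m < f u" if "u \<noteq> m" for u
  proof (rule ccontr)
    assume "\<not> f m < f u"
    then have eq: "f u = f m" using min[of u] by linarith
    have "- ((m + u) / 2) = (- m + - u) / 2" by (simp add: field_simps)
    then have "exp (- ((m + u) / 2)) \<le> (exp (- m) + exp (- u)) / 2"
      using mid[of "- m" "- u"] by (simp only:)
    then have "a * exp (- ((m + u) / 2)) \<le> (a * exp (- m) + a * exp (- u)) / 2"
      using mult_left_mono[OF _ a] by (fastforce simp: algebra_simps)
    moreover have "(p * (m - ln v) + p * (u - ln v)) / 2 = p * ((m + u) / 2 - ln v)"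
      by (simp add: field_simps)
    then have "exp (p * ((m + u) / 2 - ln v)) < (exp (p * (m - ln v)) + exp (p * (u - ln v))) / 2"
      using strict[of "p * (m - ln v)" "p * (u - ln v)"] that p by simp
    ultimately have "f ((m + u) / 2) < (f m + f u) / 2"
      unfolding f by (simp add: field_simps)
    then show False using min[of "(m + u) / 2"] eq by simp
  qed
  then have "scale_cost a v p c (exp m) < scale_cost a v p c t" if "t > 0" "t \<noteq> exp m" for t
    using that unfolding f_def by (metis exp_ln)
  then show ?thesis using exp_gt_zero by blast
qed

section \<open>Linear least squares\<close>

text \<open>The vector \<open>A x\<close> must be the point of the closed convex set \<open>range A\<close> closest to \<open>b\<close>, and
  injectivity recovers \<open>x\<close> from it.\<close>

lemma least_squares_unique_min:
  fixes A :: "'a::euclidean_space \<Rightarrow> 'b::euclidean_space"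
  assumes "linear A" "inj A"
  shows "\<exists>x. \<forall>x'. x' \<noteq> x \<longrightarrow> norm (A x - b) < norm (A x' - b)"
proof -
  have S: "subspace (range A)" using assms(1) by (simp add: linear_subspace_image)
  then have S': "convex (range A)" "closed (range A)"
    by (simp_all add: subspace_imp_convex closed_subspace)
  then obtain x where x: "closest_point (range A) b = A x"
    using closest_point_in_set[of "range A" b] by auto
  have "norm (A x - b) < norm (A x' - b)" if "x' \<noteq> x" for x'
    using closest_point_lt[OF S', of "A x'" b] that assms(2)
    by (auto simp: x dist_norm norm_minus_commute inj_eq)
  then show ?thesis by blast
qed

section \<open>Alternating minimization\<close>

text \<open>The values \<open>f (X k, W k)\<close> decrease to \<open>f (x, w)\<close>. For the second block the inequality at
  step \<open>s j + 1\<close> is used: it bounds a later value, hence also \<open>f (x, w)\<close>, by \<open>f (X (s j), w')\<close>,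
  an expression that involves the convergent \<open>X (s j)\<close> only. Continuity is asked for where \<open>f\<close> is
  below \<open>\<infinity>\<close>; at competitors with infinite value there is nothing to show.\<close>

lemma alternating_minimization_limit:
  fixes f :: "'a::t2_space \<times> 'b::t2_space \<Rightarrow> ereal"
  assumes minx: "\<And>k x. f (X k, W k) \<le> f (x, W k)"
    and minw: "\<And>k w. f (X k, W (Suc k)) \<le> f (X k, w)"
    and cont: "\<And>z. f z < \<infinity> \<Longrightarrow> isCont f z"
    and s: "strict_mono s"
    and lim: "(\<lambda>j. (X (s j), W (s j))) \<longlonglongrightarrow> (x, w)"
    and fin: "f (x, w) < \<infinity>"
  shows "f (x, w) \<le> f (x', w)" "f (x, w) \<le> f (x, w')"
proof -
  let ?F = "\<lambda>k. f (X k, W k)"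
  have Xlim: "(\<lambda>j. X (s j)) \<longlonglongrightarrow> x" and Wlim: "(\<lambda>j. W (s j)) \<longlonglongrightarrow> w"
    using tendsto_fst[OF lim] tendsto_snd[OF lim] by auto
  have dec: "decseq ?F"
    unfolding decseq_Suc_iff using minx minw order_trans by blast
  have Flim: "(\<lambda>j. ?F (s j)) \<longlonglongrightarrow> f (x, w)"
    using isCont_tendsto_compose[OF cont[OF fin] lim] .
  have low: "f (x, w) \<le> ?F n" for n
  proof -
    have "decseq (\<lambda>j. ?F (s j))"
      using dec s by (auto simp: decseq_def strict_mono_less_eq)
    then have "f (x, w) \<le> ?F (s n)" using Flim by (rule decseq_ge)
    also have "\<dots> \<le> ?F n" using dec seq_suble[OF s] by (simp add: decseq_def)
    finally show ?thesis .
  qed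
  show "f (x, w) \<le> f (x', w)"
  proof (cases "f (x', w) < \<infinity>")
    case True
    have "(\<lambda>j. f (x', W (s j))) \<longlonglongrightarrow> f (x', w)"
      by (intro isCont_tendsto_compose[OF cont[OF True]] tendsto_intros Wlim)
    then show ?thesis using Flim minx by (blast intro: LIMSEQ_le)
  qed auto
  show "f (x, w) \<le> f (x, w')"
  proof (cases "f (x, w') < \<infinity>")
    case True
    have "(\<lambda>j. f (X (s j), w')) \<longlonglongrightarrow> f (x, w')"
      by (intro isCont_tendsto_compose[OF cont[OF True]] tendsto_intros Xlim)
    moreover have "f (x, w) \<le> f (X (s j), w')" for j
      using low[of "Suc (s j)"] minx[of "Suc (s j)" "X (s j)"] minw[of "s j" w'] by order
    ultimately show ?thesis by (intro LIMSEQ_le_const) auto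
  qed auto
qed

section \<open>Stationarity from blockwise minimality\<close>

text \<open>At a point of differentiability the derivative is a regular subgradient, and constant
  sequences turn it into a limiting one.\<close>

lemma stationary_pointI:
  fixes f :: "'a::euclidean_space \<Rightarrow> ereal"
  assumes ev: "\<forall>\<^sub>F w in nhds z. f w = ereal (g w)"
    and der: "(g has_derivative (\<lambda>h. 0)) (at z)"
  shows "stationary_point f z"
proof -
  have z: "f z = ereal (g z)" using ev by (rule eventually_nhds_x_imp_x)
  have "((\<lambda>w. (g w - g z) / norm (w - z)) \<longlongrightarrow> 0) (at z)"
    using der tendsto_norm_zero_cancel[of "\<lambda>w. (g w - g z) / norm (w - z)"]
    by (simp add: has_derivative_iff_norm)
  then have "((\<lambda>w. ereal ((g w - g z) / norm (w - z))) \<longlongrightarrow> 0) (at z)"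
    by (simp add: zero_ereal_def)
  moreover have "\<forall>\<^sub>F w in at z. (f w - f z - ereal (0 \<bullet> (w - z))) / ereal (norm (w - z))
      = ereal ((g w - g z) / norm (w - z))"
    using ev[THEN filter_leD[OF at_within_le_nhds]] eventually_neq_at_within[of z z UNIV]
    by eventually_elim (simp add: z zero_ereal_def[symmetric])
  ultimately have "((\<lambda>w. (f w - f z - ereal (0 \<bullet> (w - z))) / ereal (norm (w - z))) \<longlongrightarrow> 0) (at z)"
    by (simp only: tendsto_cong)
  then have "Liminf (at z) (\<lambda>w. (f w - f z - ereal (0 \<bullet> (w - z))) / ereal (norm (w - z))) = 0"
    by (intro lim_imp_Liminf) auto
  then have "0 \<in> regular_subdifferential f z"
    unfolding regular_subdifferential_def by (simp only: mem_Collect_eq) (simp add: z)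
  then have "0 \<in> limiting_subdifferential f z"
    unfolding limiting_subdifferential_def using z
    by (intro CollectI conjI exI[of _ "\<lambda>_. z"] exI[of _ "\<lambda>_. 0"]) auto
  then show ?thesis by (simp add: stationary_point_def)
qed

lemma blockwise_min_derivative_zero:
  fixes g :: "'a::real_normed_vector \<times> 'b::real_normed_vector \<Rightarrow> real"
  assumes der: "(g has_derivative D) (at (x, w))"
    and minx: "\<forall>\<^sub>F x' in nhds x. g (x, w) \<le> g (x', w)"
    and minw: "\<forall>\<^sub>F w' in nhds w. g (x, w) \<le> g (x, w')"
  shows "D = (\<lambda>h. 0)"
proof -
  have "((\<lambda>x'. g (x', w)) has_derivative (\<lambda>h. D (h, 0))) (at x)"
    by (rule has_derivative_compose[where f = "\<lambda>x'. (x', w)" and f' = "\<lambda>h. (h, 0)"])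
      (auto intro!: derivative_eq_intros der)
  then have 1: "(\<lambda>h. D (h, 0)) = (\<lambda>h. 0)"
    using minx by (intro has_derivative_local_min) (auto intro: filter_leD[OF at_within_le_nhds])
  have "((\<lambda>w'. g (x, w')) has_derivative (\<lambda>h. D (0, h))) (at w)"
    by (rule has_derivative_compose[where f = "\<lambda>w'. (x, w')" and f' = "\<lambda>h. (0, h)"])
      (auto intro!: derivative_eq_intros der)
  then have 2: "(\<lambda>h. D (0, h)) = (\<lambda>h. 0)"
    using minw by (intro has_derivative_local_min) (auto intro: filter_leD[OF at_within_le_nhds])
  have "D (a, b) = 0" for a b
    using linear_add[OF has_derivative_linear[OF der], of "(a, 0)" "(0, b)"]
      fun_cong[OF 1, of a] fun_cong[OF 2, of b] by simp
  then show ?thesis by (auto simp: fun_eq_iff)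
qed

section \<open>The objective\<close>

text \<open>Here the weighted norm of the objective becomes separable in the components of \<open>\<theta>\<close>.\<close>

lemma norm_diag_matrix_powr:
  assumes "\<And>i. \<theta> $ i > 0"
  shows "(norm (diag_matrix (\<chi> i. \<theta> $ i powr (-1/2)) *v u))\<^sup>2 = (\<Sum>i\<in>UNIV. (u $ i)\<^sup>2 / \<theta> $ i)"
proof -
  have "(diag_matrix (\<chi> i. \<theta> $ i powr (-1/2)) *v u) $ i = \<theta> $ i powr (-1/2) * u $ i" for i
    by (simp add: diag_matrix_def matrix_vector_mult_def if_distrib[of "\<lambda>x. x * _"] cong: if_cong)
  moreover have "(\<theta> $ i powr (-1/2) * u $ i)\<^sup>2 = (u $ i)\<^sup>2 / \<theta> $ i" for i
  proof -
    have "(\<theta> $ i powr (-1/2))\<^sup>2 = \<theta> $ i powr (-1)"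
      by (simp add: power2_eq_square flip: powr_add)
    also have "\<dots> = 1 / \<theta> $ i" using assms[of i] by (simp add: powr_minus_divide)
    finally show ?thesis by (simp add: power_mult_distrib)
  qed
  ultimately show ?thesis
    by (simp add: power2_norm_eq_inner inner_vec_def flip: power2_eq_square)
qed

lemma ias_objective_eq:
  assumes "\<nu> > 0" "\<And>i. \<theta> $ i > 0"
  shows "ias_objective F y R r vt \<eta> rn vn en x \<theta> \<nu> =
    ereal ((\<Sum>i\<in>UNIV. scale_cost (((R *v x) $ i)\<^sup>2 / 2) (vt $ i) r \<eta> (\<theta> $ i))
      + scale_cost ((norm (F *v x - y))\<^sup>2 / 2) vn rn en \<nu>)"
  unfolding ias_objective_def norm_diag_matrix_powr[OF assms(2)] using assms
  by (simp add: scale_cost_def sum.distrib sum_subtractf sum_distrib_left)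

lemma scale_cost_differentiable:
  assumes "(A has_derivative A') (at z)" "(T has_derivative T') (at z)" "T z > 0" "v > 0"
  shows "(\<lambda>z. scale_cost (A z) v p c (T z)) differentiable (at z)"
  unfolding scale_cost_def differentiable_def using assms
  by (intro exI) (rule derivative_intros | simp)+

text \<open>Strict minimality at \<open>m\<close> gives existence and uniqueness at once, which is what the definite
  descriptions in the update maps require.\<close>

lemma is_arg_min_strict_iff:
  fixes f :: "'a \<Rightarrow> 'b::linorder"
  assumes "\<And>y. y \<noteq> m \<Longrightarrow> f m < f y"
  shows "is_arg_min f (\<lambda>_. True) x \<longleftrightarrow> x = m"
  unfolding is_arg_min_linorder using assms by (metis order.order_iff_strict not_le)

text \<open>The products \<open>r * \<eta>\<close> and \<open>rn * en\<close> are positive in both cases of the sign assumptions of the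
  theorem, so the cases can be treated together.\<close>

locale ias_model =
  fixes F :: "real ^ 'n ^ 'm" and y :: "real ^ 'm" and R :: "real ^ 'n ^ 'k"
    and r rn \<eta> en vn :: real and vt :: "real ^ 'k"
  assumes ker: "{x. F *v x = 0} \<inter> {x. R *v x = 0} = {0}"
    and r: "r * \<eta> > 0" and rn: "rn * en > 0"
    and vt: "\<And>i. vt $ i > 0" and vn: "vn > 0"
begin

abbreviation "G \<equiv> ias_objective F y R r vt \<eta> rn vn en"

abbreviation "theta_cost x i \<equiv> scale_cost (((R *v x) $ i)\<^sup>2 / 2) (vt $ i) r \<eta>"

abbreviation "nu_cost x \<equiv> scale_cost ((norm (F *v x - y))\<^sup>2 / 2) vn rn en"

text \<open>A real-valued representative of the objective, taken as a function of the triple so that it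
  can be differentiated. It agrees with the objective where all scales are positive.\<close>

definition finite_objective :: "(real ^ 'n) \<times> (real ^ 'k) \<times> real \<Rightarrow> real" where
  "finite_objective z =
    (\<Sum>i\<in>UNIV. theta_cost (fst z) i (fst (snd z) $ i)) + nu_cost (fst z) (snd (snd z))"

definition effective_domain :: "((real ^ 'n) \<times> (real ^ 'k) \<times> real) set" where
  "effective_domain = {z. (\<forall>i. fst (snd z) $ i > 0) \<and> snd (snd z) > 0}"

lemma objective_finite:
  "z \<in> effective_domain \<Longrightarrow> (case z of (x, \<theta>, \<nu>) \<Rightarrow> G x \<theta> \<nu>) = ereal (finite_objective z)"
  by (cases z) (simp add: effective_domain_def ias_objective_eq finite_objective_def)

lemma objective_infinite:
  "z \<notin> effective_domain \<Longrightarrow> (case z of (x, \<theta>, \<nu>) \<Rightarrow> G x \<theta> \<nu>) = \<infinity>"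
  by (cases z) (auto simp: effective_domain_def ias_objective_def)

lemma open_effective_domain: "open effective_domain"
proof -
  have "open ((\<Inter>i. {z. 0 < fst (snd z) $ i}) \<inter> {z::(real ^ 'n) \<times> (real ^ 'k) \<times> real. 0 < snd (snd z)})"
    by (intro open_Int open_INT ballI finite open_Collect_less continuous_intros)
  also have "(\<Inter>i. {z. 0 < fst (snd z) $ i}) \<inter> {z. 0 < snd (snd z)} = effective_domain"
    by (auto simp: effective_domain_def)
  finally show ?thesis .
qed

lemma finite_objective_differentiable:
  assumes "z \<in> effective_domain"
  shows "finite_objective differentiable (at z)"
proof -
  have R: "((\<lambda>z. ((R *v fst z) $ i)\<^sup>2 / 2) has_derivative
      (\<lambda>h. (2 * ((R *v fst h) $ i * (R *v fst z) $ i)) / 2)) (at z)" for i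
  proof -
    have "bounded_linear (\<lambda>z::(real ^ 'n) \<times> (real ^ 'k) \<times> real. (R *v fst z) $ i)"
      by (intro bounded_linear_compose[OF bounded_linear_vec_nth]
          bounded_linear_compose[OF matrix_vector_mul_bounded_linear] bounded_linear_fst)
    from bounded_linear_imp_has_derivative[OF this]
    show ?thesis by (auto intro!: derivative_eq_intros)
  qed
  have "((\<lambda>z::(real ^ 'n) \<times> (real ^ 'k) \<times> real. F *v fst z) has_derivative (\<lambda>h. F *v fst h)) (at z)"
    by (intro bounded_linear_imp_has_derivative
        bounded_linear_compose[OF matrix_vector_mul_bounded_linear] bounded_linear_fst)
  then have F: "((\<lambda>z. (norm (F *v fst z - y))\<^sup>2 / 2) has_derivative
      (\<lambda>h. ((F *v fst z - y) \<bullet> (F *v fst h) + (F *v fst h) \<bullet> (F *v fst z - y)) / 2)) (at z)"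
    unfolding power2_norm_eq_inner by (auto intro!: derivative_eq_intros)
  have T: "((\<lambda>z::(real ^ 'n) \<times> (real ^ 'k) \<times> real. fst (snd z) $ i) has_derivative
      (\<lambda>h. fst (snd h) $ i)) (at z)" for i
    by (intro bounded_linear_imp_has_derivative bounded_linear_compose[OF bounded_linear_vec_nth]
        bounded_linear_compose[OF bounded_linear_fst] bounded_linear_snd)
  have N: "((\<lambda>z::(real ^ 'n) \<times> (real ^ 'k) \<times> real. snd (snd z)) has_derivative
      (\<lambda>h. snd (snd h))) (at z)"
    by (intro derivative_intros)
  show ?thesis
    unfolding finite_objective_def[abs_def] using assms vt vn
    by (intro differentiable_add differentiable_sum finite ballI
        scale_cost_differentiable[OF R T] scale_cost_differentiable[OF F N])
      (auto simp: effective_domain_def)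
qed

text \<open>The part of the objective that contains \<open>\<theta>\<close> is separable and free of \<open>\<nu>\<close>, so the vector of
  scalar minimizers is the strict minimizer for all \<open>\<nu> > 0\<close> simultaneously.\<close>

lemma theta_update_minimizes:
  "(\<forall>i. theta_update G x $ i > 0) \<and> (\<forall>\<nu>>0. \<forall>\<theta>. G x (theta_update G x) \<nu> \<le> G x \<theta> \<nu>)"
proof -
  have "\<exists>m>0. \<forall>t>0. t \<noteq> m \<longrightarrow> theta_cost x i m < theta_cost x i t" for i
    using r vt by (intro scale_cost_unique_min) auto
  then obtain m where m: "\<And>i. m i > 0"
      "\<And>i t. t > 0 \<Longrightarrow> t \<noteq> m i \<Longrightarrow> theta_cost x i (m i) < theta_cost x i t"
    by metis
  define \<theta>m where "\<theta>m = (\<chi> i. m i)"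
  have strict: "G x \<theta>m \<nu> < G x \<theta> \<nu>" if "\<nu> > 0" "\<theta> \<noteq> \<theta>m" for \<theta> \<nu>
  proof (cases "\<forall>i. \<theta> $ i > 0")
    case True
    obtain i where "\<theta> $ i \<noteq> m i" using \<open>\<theta> \<noteq> \<theta>m\<close> by (auto simp: \<theta>m_def vec_eq_iff)
    then have "theta_cost x i (m i) < theta_cost x i (\<theta> $ i)" using True m(2) by simp
    moreover have "theta_cost x j (m j) \<le> theta_cost x j (\<theta> $ j)" for j
      using True m(2)[of "\<theta> $ j" j] by (cases "\<theta> $ j = m j") auto
    ultimately have "(\<Sum>i\<in>UNIV. theta_cost x i (m i)) < (\<Sum>i\<in>UNIV. theta_cost x i (\<theta> $ i))"
      by (intro sum_strict_mono_ex1) auto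
    then show ?thesis using that True m(1) by (simp add: ias_objective_eq \<theta>m_def)
  next
    case False
    then show ?thesis using that m(1) by (auto simp: ias_objective_def \<theta>m_def)
  qed
  have "theta_update G x = \<theta>m"
    unfolding theta_update_def
  proof (rule the_equality)
    show "\<forall>\<nu>>0. is_arg_min (\<lambda>\<theta>. G x \<theta> \<nu>) (\<lambda>_. True) \<theta>m"
      using is_arg_min_strict_iff[of \<theta>m "\<lambda>\<theta>. G x \<theta> _"] strict by blast
  next
    fix \<theta> assume "\<forall>\<nu>>0. is_arg_min (\<lambda>\<theta>. G x \<theta> \<nu>) (\<lambda>_. True) \<theta>"
    then have "is_arg_min (\<lambda>\<theta>. G x \<theta> 1) (\<lambda>_. True) \<theta>" by simp
    then show "\<theta> = \<theta>m" using is_arg_min_strict_iff[of \<theta>m "\<lambda>\<theta>. G x \<theta> 1"] strict by simp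
  qed
  then show ?thesis using m(1) strict by (auto simp: \<theta>m_def intro: less_imp_le) (metis less_imp_le order_refl)
qed

lemma nu_update_minimizes:
  assumes \<theta>: "\<And>i. \<theta> $ i > 0"
  shows "nu_update G x \<theta> > 0 \<and> (\<forall>\<nu>. G x \<theta> (nu_update G x \<theta>) \<le> G x \<theta> \<nu>)"
proof -
  have "\<exists>m>0. \<forall>t>0. t \<noteq> m \<longrightarrow> nu_cost x m < nu_cost x t"
    using rn vn by (intro scale_cost_unique_min) auto
  then obtain m where m: "m > 0" "\<And>t. t > 0 \<Longrightarrow> t \<noteq> m \<Longrightarrow> nu_cost x m < nu_cost x t"
    by blast
  have strict: "G x \<theta> m < G x \<theta> \<nu>" if "\<nu> \<noteq> m" for \<nu>
  proof (cases "\<nu> > 0")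
    case True
    then show ?thesis using that m \<theta> by (simp add: ias_objective_eq)
  next
    case False
    then show ?thesis using m(1) \<theta> by (simp add: ias_objective_def)
  qed
  then have "is_arg_min (\<lambda>\<nu>. G x \<theta> \<nu>) (\<lambda>_. True) \<nu> \<longleftrightarrow> \<nu> = m" for \<nu>
    by (rule is_arg_min_strict_iff)
  then have "nu_update G x \<theta> = m" by (simp add: nu_update_def)
  then show ?thesis using m(1) strict by (metis less_imp_le order_refl)
qed

lemma inj_joint_map: "inj (\<lambda>x. (F *v x, R *v x))"
proof (rule injI)
  fix a b assume "(F *v a, R *v a) = (F *v b, R *v b)"
  then have "a - b \<in> {x. F *v x = 0} \<inter> {x. R *v x = 0}"
    by (simp add: matrix_vector_mult_diff_distrib)
  then show "a = b" using ker by simp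
qed

text \<open>As a function of \<open>x\<close> the objective is, up to a constant, half the squared distance of
  \<open>(F x / sqrt \<nu>, D R x)\<close> to \<open>(y / sqrt \<nu>, 0)\<close>, where \<open>D\<close> is diagonal with entries
  \<open>1 / sqrt (\<theta> $ i)\<close>. Trivial joint kernel means that this map is injective.\<close>

lemma x_update_minimizes:
  assumes \<theta>: "\<And>i. \<theta> $ i > 0" and \<nu>: "\<nu> > 0"
  shows "G (x_update G \<theta> \<nu>) \<theta> \<nu> \<le> G x \<theta> \<nu>"
proof -
  define A where "A x = ((1 / sqrt \<nu>) *\<^sub>R (F *v x), \<chi> i. (R *v x) $ i / sqrt (\<theta> $ i))" for x
  define b :: "(real ^ 'm) \<times> (real ^ 'k)" where "b = ((1 / sqrt \<nu>) *\<^sub>R y, 0)"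
  have "linear A"
    by (rule linearI) (simp_all add: A_def vec_eq_iff matrix_vector_right_distrib scaleR_add_right
        add_divide_distrib matrix_vector_mult_scaleR)
  moreover have "inj A"
  proof (rule injI)
    fix a b assume "A a = A b"
    then have "F *v a = F *v b" "\<And>i. (R *v a) $ i / sqrt (\<theta> $ i) = (R *v b) $ i / sqrt (\<theta> $ i)"
      using \<nu> by (auto simp: A_def vec_eq_iff)
    then have "(F *v a, R *v a) = (F *v b, R *v b)"
      using \<theta> by (auto simp: vec_eq_iff less_imp_neq[symmetric])
    then show "a = b" using inj_joint_map by (auto dest: injD)
  qed
  ultimately obtain m where m: "\<And>x. x \<noteq> m \<Longrightarrow> norm (A m - b) < norm (A x - b)"
    using least_squares_unique_min[of A b] by blast
  have quad: "(norm (A x - b))\<^sup>2 = (\<Sum>i\<in>UNIV. ((R *v x) $ i)\<^sup>2 / \<theta> $ i) + (norm (F *v x - y))\<^sup>2 / \<nu>" for x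
  proof -
    have "A x - b = ((1 / sqrt \<nu>) *\<^sub>R (F *v x - y), \<chi> i. (R *v x) $ i / sqrt (\<theta> $ i))"
      by (simp add: A_def b_def scaleR_diff_right)
    then show ?thesis
      using \<nu> \<theta> by (simp add: norm_Pair power_divide power2_norm_eq_inner[of "vec_lambda _"] inner_vec_def
          less_imp_le sum_nonneg flip: power2_eq_square)
  qed
  obtain K where K: "\<And>x. G x \<theta> \<nu> = ereal ((norm (A x - b))\<^sup>2 / 2 + K)"
  proof
    show "G x \<theta> \<nu> = ereal ((norm (A x - b))\<^sup>2 / 2
        + ((\<Sum>i\<in>UNIV. scale_cost 0 (vt $ i) r \<eta> (\<theta> $ i)) + scale_cost 0 vn rn en \<nu>))" for x
      using \<theta> \<nu> by (simp add: ias_objective_eq quad scale_cost_def sum.distrib sum_subtractf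
          sum_divide_distrib add_divide_distrib mult.commute)
  qed
  have strict: "G m \<theta> \<nu> < G x \<theta> \<nu>" if "x \<noteq> m" for x
    using m[OF that] by (simp add: K power_strict_mono)
  then have "is_arg_min (\<lambda>x. G x \<theta> \<nu>) (\<lambda>_. True) x \<longleftrightarrow> x = m" for x
    by (rule is_arg_min_strict_iff)
  then have "x_update G \<theta> \<nu> = m" by (simp add: x_update_def)
  then show ?thesis using strict by (metis less_imp_le order_refl)
qed

text \<open>The updates of \<open>\<theta>\<close> and \<open>\<nu>\<close> together minimize over the pair: pass from \<open>(\<theta>', \<nu>')\<close> to
  \<open>(\<theta>, \<nu>')\<close>, which is possible because \<open>\<theta>\<close> is optimal for every \<open>\<nu>'\<close>, and then to \<open>(\<theta>, \<nu>)\<close>.\<close>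

lemma ias_step_minimizes:
  fixes x
  defines "z \<equiv> ias_step G x"
  shows "z \<in> effective_domain"
    and "(case (x, snd z) of (x, \<theta>, \<nu>) \<Rightarrow> G x \<theta> \<nu>) \<le> (case (x, w) of (x, \<theta>, \<nu>) \<Rightarrow> G x \<theta> \<nu>)"
    and "(case z of (x, \<theta>, \<nu>) \<Rightarrow> G x \<theta> \<nu>) \<le> (case (x', snd z) of (x, \<theta>, \<nu>) \<Rightarrow> G x \<theta> \<nu>)"
proof -
  define \<theta> where "\<theta> = theta_update G x"
  define \<nu> where "\<nu> = nu_update G x \<theta>"
  have z: "z = (x_update G \<theta> \<nu>, \<theta>, \<nu>)"
    by (simp add: z_def ias_step_def \<theta>_def \<nu>_def Let_def)
  have \<theta>: "\<And>i. \<theta> $ i > 0" "\<And>\<nu> \<theta>'. \<nu> > 0 \<Longrightarrow> G x \<theta> \<nu> \<le> G x \<theta>' \<nu>"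
    using theta_update_minimizes[of x] by (auto simp: \<theta>_def)
  have \<nu>: "\<nu> > 0" "\<And>\<nu>'. G x \<theta> \<nu> \<le> G x \<theta> \<nu>'"
    using nu_update_minimizes[of \<theta> x] \<theta>(1) by (auto simp: \<nu>_def)
  show "z \<in> effective_domain"
    using \<theta>(1) \<nu>(1) by (simp add: z effective_domain_def)
  have "G x \<theta> \<nu> \<le> G x (fst w) (snd w)"
  proof (cases "snd w > 0")
    case True
    then show ?thesis using \<theta>(2) \<nu>(2) order_trans by blast
  next
    case False
    then show ?thesis by (simp add: ias_objective_def[of _ _ _ _ _ _ _ _ _ _ "fst w"])
  qed
  then show "(case (x, snd z) of (x, \<theta>, \<nu>) \<Rightarrow> G x \<theta> \<nu>) \<le> (case (x, w) of (x, \<theta>, \<nu>) \<Rightarrow> G x \<theta> \<nu>)"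
    by (simp add: z case_prod_beta)
  show "(case z of (x, \<theta>, \<nu>) \<Rightarrow> G x \<theta> \<nu>) \<le> (case (x', snd z) of (x, \<theta>, \<nu>) \<Rightarrow> G x \<theta> \<nu>)"
    using x_update_minimizes[OF \<theta>(1) \<nu>(1)] by (simp add: z)
qed

text \<open>After the constants from the coercivity bounds are moved to the right-hand side, a sum of
  nonnegative terms is at most \<open>Q\<close>, so each of them is. The logarithmic terms confine the scales to
  \<open>{exp (- M)..exp M}\<close>; since the scales are then bounded above, the quotients residual over scale
  bound \<open>R *v x\<close> and \<open>F *v x\<close>; injectivity of \<open>x \<mapsto> (F *v x, R *v x)\<close> bounds \<open>x\<close>.\<close>

lemma sublevel_set_in_compact:
  "\<exists>S. compact S \<and> S \<subseteq> effective_domain \<and>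
    (\<forall>z\<in>effective_domain. finite_objective z \<le> c \<longrightarrow> z \<in> S)"
proof -
  obtain C where C: "\<And>i a t. t > 0 \<Longrightarrow> a / t + \<bar>\<eta>\<bar> * \<bar>ln t\<bar> - C i \<le> scale_cost a (vt $ i) r \<eta> t"
    using scale_cost_coercive[OF r vt] by metis
  obtain D where D: "\<And>a t. t > 0 \<Longrightarrow> a / t + \<bar>en\<bar> * \<bar>ln t\<bar> - D \<le> scale_cost a vn rn en t"
    using scale_cost_coercive[OF rn vn] by metis
  obtain e where e: "e > 0" "\<And>x. e * norm x \<le> norm (F *v x, R *v x)"
  proof -
    have "linear (\<lambda>x. (F *v x, R *v x))"
      by (rule linearI) (simp_all add: matrix_vector_right_distrib matrix_vector_mult_scaleR)
    then show ?thesis using linear_inj_bounded_below_pos[OF _ inj_joint_map] that by blast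
  qed
  have pos: "\<bar>\<eta>\<bar> > 0" "\<bar>en\<bar> > 0" using r rn by auto
  define Q where "Q = c + (\<Sum>i\<in>UNIV. C i) + D"
  define M where "M = Q / \<bar>\<eta>\<bar> + Q / \<bar>en\<bar>"
  define P where "P = sqrt (2 * Q * exp M)"
  define B where "B = (norm y + P + real CARD('k) * P) / e"
  define S :: "((real ^ 'n) \<times> (real ^ 'k) \<times> real) set"
    where "S = cball 0 B \<times> cbox (\<chi> i. exp (- M)) (\<chi> i. exp M) \<times> {exp (- M)..exp M}"
  have "compact S" unfolding S_def by (intro compact_Times compact_cball compact_cbox compact_Icc)
  moreover have "S \<subseteq> effective_domain"
    by (auto simp: S_def effective_domain_def mem_box_cart) (meson exp_gt_zero less_le_trans)+
  moreover have "z \<in> S" if z: "z \<in> effective_domain" and le: "finite_objective z \<le> c" for z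
  proof -
    obtain x \<theta> \<nu> where zeq: "z = (x, \<theta>, \<nu>)" by (cases z)
    have \<theta>: "\<theta> $ i > 0" for i using z by (simp add: effective_domain_def zeq)
    have \<nu>: "\<nu> > 0" using z by (simp add: effective_domain_def zeq)
    let ?a = "\<lambda>i. ((R *v x) $ i)\<^sup>2 / 2" and ?d = "(norm (F *v x - y))\<^sup>2 / 2"
    have "(\<Sum>i\<in>UNIV. ?a i / \<theta> $ i + \<bar>\<eta>\<bar> * \<bar>ln (\<theta> $ i)\<bar> - C i) + (?d / \<nu> + \<bar>en\<bar> * \<bar>ln \<nu>\<bar> - D)
        \<le> finite_objective z"
      unfolding finite_objective_def zeq fst_conv snd_conv by (intro add_mono sum_mono C D \<theta> \<nu>)
    then have total: "(\<Sum>i\<in>UNIV. ?a i / \<theta> $ i + \<bar>\<eta>\<bar> * \<bar>ln (\<theta> $ i)\<bar>) + (?d / \<nu> + \<bar>en\<bar> * \<bar>ln \<nu>\<bar>) \<le> Q"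
      using le by (simp add: Q_def sum_subtractf)
    have a0: "?a i / \<theta> $ i \<ge> 0" for i using \<theta>[of i] by simp
    have d0: "?d / \<nu> \<ge> 0" using \<nu> by simp
    have l0: "\<bar>\<eta>\<bar> * \<bar>ln t\<bar> \<ge> 0" "\<bar>en\<bar> * \<bar>ln t\<bar> \<ge> 0" for t by simp_all
    have sum0: "(\<Sum>i\<in>UNIV. ?a i / \<theta> $ i + \<bar>\<eta>\<bar> * \<bar>ln (\<theta> $ i)\<bar>) \<ge> 0"
      by (intro sum_nonneg add_nonneg_nonneg a0 l0)
    have term_i: "?a i / \<theta> $ i + \<bar>\<eta>\<bar> * \<bar>ln (\<theta> $ i)\<bar> \<le> Q" for i
    proof -
      have "?a i / \<theta> $ i + \<bar>\<eta>\<bar> * \<bar>ln (\<theta> $ i)\<bar> \<le> (\<Sum>i\<in>UNIV. ?a i / \<theta> $ i + \<bar>\<eta>\<bar> * \<bar>ln (\<theta> $ i)\<bar>)"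
        using a0 l0 by (intro member_le_sum) (auto intro: add_nonneg_nonneg)
      then show ?thesis using total d0 l0(2)[of \<nu>] by linarith
    qed
    have term_n: "?d / \<nu> + \<bar>en\<bar> * \<bar>ln \<nu>\<bar> \<le> Q" using total sum0 by linarith
    have Q: "Q \<ge> 0" using term_n d0 l0(2)[of \<nu>] by linarith
    have "\<bar>ln (\<theta> $ i)\<bar> \<le> Q / \<bar>\<eta>\<bar>" for i
      using term_i[of i] a0[of i] pos by (simp add: pos_le_divide_eq mult.commute)
    moreover have "\<bar>ln \<nu>\<bar> \<le> Q / \<bar>en\<bar>"
      using term_n d0 pos by (simp add: pos_le_divide_eq mult.commute)
    moreover have "Q / \<bar>\<eta>\<bar> \<ge> 0" "Q / \<bar>en\<bar> \<ge> 0" using Q by auto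
    ultimately have ln: "\<forall>i. \<bar>ln (\<theta> $ i)\<bar> \<le> M" "\<bar>ln \<nu>\<bar> \<le> M"
      unfolding M_def by (auto intro: add_increasing add_increasing2)
    have ln_bound: "exp (- M) \<le> t \<and> t \<le> exp M" if "\<bar>ln t\<bar> \<le> M" "t > 0" for t
      using that by (metis abs_le_D1 abs_le_D2 exp_le_cancel_iff exp_ln minus_le_iff)
    have \<theta>b: "exp (- M) \<le> \<theta> $ i" "\<theta> $ i \<le> exp M" for i using ln_bound ln \<theta> by auto
    have \<nu>b: "exp (- M) \<le> \<nu>" "\<nu> \<le> exp M" using ln_bound ln \<nu> by auto
    have quad: "\<bar>s\<bar> \<le> P" if "s\<^sup>2 / 2 / t \<le> Q" "t > 0" "t \<le> exp M" for s t
    proof -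
      have "s\<^sup>2 \<le> 2 * Q * t" using that by (simp add: pos_divide_le_eq)
      also have "\<dots> \<le> 2 * Q * exp M" using Q that by (intro mult_left_mono) auto
      finally show ?thesis unfolding P_def by (metis real_sqrt_abs real_sqrt_le_iff)
    qed
    have "norm (F *v x - y) \<le> P"
      using quad[of "norm (F *v x - y)" \<nu>] term_n l0(2)[of \<nu>] \<nu> \<nu>b by simp
    then have "norm (F *v x) \<le> norm y + P"
      using norm_triangle_sub[of "F *v x" y] by linarith
    moreover have "\<bar>(R *v x) $ i\<bar> \<le> P" for i
      using quad[of "(R *v x) $ i" "\<theta> $ i"] term_i[of i] l0(1)[of "\<theta> $ i"] \<theta>[of i] \<theta>b[of i] by linarith
    then have "norm (R *v x) \<le> real CARD('k) * P"
      using norm_le_l1_cart[of "R *v x"] sum_bounded_above[of UNIV "\<lambda>i. \<bar>(R *v x) $ i\<bar>" P] by simp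
    ultimately have "e * norm x \<le> norm y + P + real CARD('k) * P"
      using e(2)[of x] norm_Pair_le[of "F *v x" "R *v x"] by linarith
    then have "norm x \<le> B" using e(1) by (simp add: B_def pos_le_divide_eq mult.commute)
    then show ?thesis using \<theta>b \<nu>b by (simp add: S_def zeq mem_box_cart)
  qed
  ultimately show ?thesis by blast
qed

theorem ias_bounded_and_stationary:
  shows "bounded (range (ias_iterate G x0))"
    and "sequence_limit_point (ias_iterate G x0) z \<Longrightarrow> stationary_point (\<lambda>(x, \<theta>, \<nu>). G x \<theta> \<nu>) z"
proof -
  let ?G = "\<lambda>z. case z of (x, \<theta>, \<nu>) \<Rightarrow> G x \<theta> \<nu>"
  let ?Z = "ias_iterate G x0"
  have step: "?Z k = ias_step G (if k = 0 then x0 else fst (?Z (k - 1)))" for k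
    by (cases k) auto
  have dom: "?Z k \<in> effective_domain" for k
    by (subst step) (rule ias_step_minimizes(1))
  have minx: "?G (?Z k) \<le> ?G (x, snd (?Z k))" for k x
    using ias_step_minimizes(3) by (subst (1 2) step)
  have minw: "?G (fst (?Z k), snd (?Z (Suc k))) \<le> ?G (fst (?Z k), w)" for k w
    using ias_step_minimizes(2)[of "fst (?Z k)" w] by simp
  have "finite_objective (?Z (Suc k)) \<le> finite_objective (?Z k)" for k
  proof -
    have "?G (?Z (Suc k)) \<le> ?G (?Z k)"
      using minx[of "Suc k" "fst (?Z k)"] minw[of k "snd (?Z k)"] order_trans by (simp only: prod.collapse)
    then show ?thesis by (simp only: objective_finite dom ereal_less_eq)
  qed
  then have le0: "finite_objective (?Z k) \<le> finite_objective (?Z 0)" for k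
    by (induction k) (auto intro: order_trans)
  from sublevel_set_in_compact[of "finite_objective (?Z 0)"]
  obtain S where S: "compact S" "S \<subseteq> effective_domain"
      "\<forall>z\<in>effective_domain. finite_objective z \<le> finite_objective (?Z 0) \<longrightarrow> z \<in> S"
    by (elim exE conjE)
  have in_S: "?Z k \<in> S" for k
    using S(3)[rule_format, OF dom le0] .
  show "bounded (range ?Z)"
    using in_S by (intro bounded_subset[OF compact_imp_bounded[OF S(1)]]) blast
  show "stationary_point ?G z" if lp: "sequence_limit_point ?Z z"
  proof -
    obtain s where s: "strict_mono s" "(\<lambda>j. ?Z (s j)) \<longlonglongrightarrow> z"
      using lp by (auto simp: sequence_limit_point_def o_def)
    have "z \<in> S"
      using s(2) in_S by (intro Lim_in_closed_set[OF compact_imp_closed[OF S(1)]]) (auto simp del: ias_iterate.simps)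
    then have z: "z \<in> effective_domain" using S(2) by blast
    have near: "\<forall>\<^sub>F w in nhds z. ?G w = ereal (finite_objective w)" if "z \<in> effective_domain" for z
      using eventually_nhds_in_open[OF open_effective_domain that]
      by eventually_elim (rule objective_finite)
    have cont: "isCont ?G z" if "?G z < \<infinity>" for z
    proof -
      have "z \<in> effective_domain" using objective_infinite[of z] that by force
      moreover from this have "isCont (\<lambda>w. ereal (finite_objective w)) z"
        by (intro continuous_intros differentiable_imp_continuous_within
            finite_objective_differentiable)
      ultimately show ?thesis using isCont_cong[OF near] by blast
    qed
    have fin: "?G (fst z, snd z) < \<infinity>" using z by (simp only: prod.collapse objective_finite) simp
    have min: "?G (fst z, snd z) \<le> ?G (x, snd z)" "?G (fst z, snd z) \<le> ?G (fst z, w)" for x w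
      using alternating_minimization_limit[of ?G "\<lambda>k. fst (?Z k)" "\<lambda>k. snd (?Z k)", OF _ minw cont s(1) _ fin]
        minx s(2) by (simp_all only: prod.collapse)
    obtain D where D: "(finite_objective has_derivative D) (at z)"
      using finite_objective_differentiable[OF z] by (auto simp: differentiable_def)
    have "D = (\<lambda>h. 0)"
    proof (rule blockwise_min_derivative_zero)
      show "(finite_objective has_derivative D) (at (fst z, snd z))" using D by simp
    next
      show "\<forall>\<^sub>F x in nhds (fst z). finite_objective (fst z, snd z) \<le> finite_objective (x, snd z)"
      proof (intro always_eventually allI)
        fix x
        have "(x, snd z) \<in> effective_domain" using z by (simp add: effective_domain_def)
        then show "finite_objective (fst z, snd z) \<le> finite_objective (x, snd z)"
          using min(1)[of x] z by (simp only: prod.collapse objective_finite) simp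
      qed
    next
      have "((\<lambda>w. (fst z, w)) \<longlongrightarrow> z) (nhds (snd z))"
        using tendsto_Pair[OF tendsto_const[of "fst z"] filterlim_ident, of "snd z"] by simp
      then have "\<forall>\<^sub>F w in nhds (snd z). (fst z, w) \<in> effective_domain"
        using z open_effective_domain by (intro topological_tendstoD)
      then show "\<forall>\<^sub>F w in nhds (snd z). finite_objective (fst z, snd z) \<le> finite_objective (fst z, w)"
      proof eventually_elim
        case (elim w)
        then show ?case using min(2)[of w] z by (simp only: prod.collapse objective_finite) simp
      qed
    qed
    then show ?thesis using stationary_pointI[OF near[OF z]] D by simp
  qed
qed

end

theorem theorem3p5:
  fixes F :: "real ^ 'n ^ 'm" and y :: "real ^ 'm" and R :: "real ^ 'n ^ 'k"
    and r rn \<beta> \<beta>n \<eta> en vn :: real and vt :: "real ^ 'k"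
    and G :: "real ^ 'n \<Rightarrow> real ^ 'k \<Rightarrow> real \<Rightarrow> ereal" and x0 :: "real ^ 'n"
  assumes "{x. F *v x = 0} \<inter> {x. R *v x = 0} = {0}"
    and "r \<noteq> 0" and "rn \<noteq> 0"
    and "\<beta> > 0" and "\<beta>n > 0"
    and "\<And>i. vt $ i > 0" and "vn > 0"
    and "\<eta> = r * \<beta> - 3 / 2"
    and "en = rn * \<beta>n - (real CARD('m) + 2) / 2"
    and "(r < 0 \<and> \<eta> < - (3 / 2)) \<or> (r > 0 \<and> \<eta> > 0)"
    and "(rn < 0 \<and> en < - ((real CARD('m) + 2) / 2)) \<or> (rn > 0 \<and> en > 0)"
    and "G = ias_objective F y R r vt \<eta> rn vn en"
  shows "bounded (range (ias_iterate G x0)) \<and>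
    (\<forall>z. sequence_limit_point (ias_iterate G x0) z \<longrightarrow>
         stationary_point (\<lambda>(x, \<theta>, \<nu>). G x \<theta> \<nu>) z)"
proof -
  interpret ias_model F y R r rn \<eta> en vn vt
    using assms by unfold_locales (auto simp: zero_less_mult_iff)
  show ?thesis using ias_bounded_and_stationary assms(12) by blast
qed

end
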